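(* Let $q\in[0,1]$. For $\overline{\gamma}>0$ let $\overline{C}^{\text{Hoyt}}(\overline{\gamma})=\mathbb{E}\{\log_2(1+\gamma)\}$, where $\gamma$ follows the squared Hoyt distribution with average $\overline{\gamma}$ and parameter $q$. Then, in the low-SNR regime, $\overline{C}^{\text{Hoyt}}(\overline{\gamma})$ is asymptotically equal to $\log_2(e)\,\overline{\gamma}$, i.e. $$\lim_{\overline{\gamma}\to 0^+}\frac{\overline{C}^{\text{Hoyt}}(\overline{\gamma})}{\log_2(e)\,\overline{\gamma}}=1.$$
   Context: The squared Hoyt distribution with average $\overline{\gamma}>0$ and parameter $q\in[0,1]$ is the distribution of $X^2+Y^2$, where $X,Y$ are independent zero-mean Gaussian random variables with variances $\sigma_x^2>0$ and $\sigma_y^2=q^2\sigma_x^2$, and $\overline{\gamma}=\sigma_x^2+\sigma_y^2$ (for $q=0$, $Y=0$ almost surely). *)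

theory Defs
  imports "HOL-Probability.Probability"
begin

text \<open>Zero-mean Gaussian law with variance \<open>v \<ge> 0\<close>; for \<open>v = 0\<close> it is the point mass at \<open>0\<close>.\<close>

definition centered_gaussian :: "real \<Rightarrow> real measure" where
  "centered_gaussian v =
     (if v = 0 then return borel 0 else density lborel (normal_density 0 (sqrt v)))"

text \<open>Solving \<open>\<sigma>\<^sub>y\<^sup>2 = q\<^sup>2 \<sigma>\<^sub>x\<^sup>2\<close> and \<open>\<sigma>\<^sub>x\<^sup>2 + \<sigma>\<^sub>y\<^sup>2 = g\<close> for the two variances
  (see \<open>hoyt_variances_iff\<close>).\<close>

definition hoyt_var_x :: "real \<Rightarrow> real \<Rightarrow> real" where
  "hoyt_var_x q g = g / (1 + q\<^sup>2)"

definition hoyt_var_y :: "real \<Rightarrow> real \<Rightarrow> real" where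
  "hoyt_var_y q g = q\<^sup>2 * hoyt_var_x q g"

text \<open>The law of \<open>X\<^sup>2 + Y\<^sup>2\<close>; independence of \<open>X\<close> and \<open>Y\<close> is the product measure
  (see \<open>distr_squared_hoyt\<close>).\<close>

definition squared_hoyt :: "real \<Rightarrow> real \<Rightarrow> real measure" where
  "squared_hoyt q g =
     distr (centered_gaussian (hoyt_var_x q g) \<Otimes>\<^sub>M centered_gaussian (hoyt_var_y q g)) borel
       (\<lambda>(x, y). x\<^sup>2 + y\<^sup>2)"

definition hoyt_capacity :: "real \<Rightarrow> real \<Rightarrow> real" where
  "hoyt_capacity q g = (\<integral>\<gamma>. log 2 (1 + \<gamma>) \<partial>squared_hoyt q g)"

lemma hoyt_variances_iff:
  fixes g q vx vy :: real
  shows "vy = q\<^sup>2 * vx \<and> vx + vy = g \<longleftrightarrow> vx = hoyt_var_x q g \<and> vy = hoyt_var_y q g"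
proof -
  have "1 + q\<^sup>2 \<noteq> 0"
    by (metis add_pos_nonneg less_numeral_extra(1) less_irrefl zero_le_power2)
  then have "vx = hoyt_var_x q g \<longleftrightarrow> vx * (1 + q\<^sup>2) = g"
    by (simp add: hoyt_var_x_def eq_divide_eq)
  also have "\<dots> \<longleftrightarrow> vx + q\<^sup>2 * vx = g"
    by (simp add: algebra_simps)
  finally show ?thesis
    unfolding hoyt_var_y_def by metis
qed

lemma sets_centered_gaussian [measurable_cong, simp]: "sets (centered_gaussian v) = sets borel"
  by (simp add: centered_gaussian_def)

lemma prob_space_centered_gaussian:
  assumes "v \<ge> 0"
  shows "prob_space (centered_gaussian v)"
  using assms by (auto simp: centered_gaussian_def intro: prob_space_return prob_space_normal_density)

lemma prob_space_squared_hoyt: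
  assumes "g > 0"
  shows "prob_space (squared_hoyt q g)"
proof -
  have "hoyt_var_x q g \<ge> 0" "hoyt_var_y q g \<ge> 0"
    using assms by (auto simp: hoyt_var_x_def hoyt_var_y_def)
  then interpret A: prob_space "centered_gaussian (hoyt_var_x q g)" +
      B: prob_space "centered_gaussian (hoyt_var_y q g)"
    by (auto intro: prob_space_centered_gaussian)
  interpret pair_prob_space "centered_gaussian (hoyt_var_x q g)" "centered_gaussian (hoyt_var_y q g)" ..
  show ?thesis
    unfolding squared_hoyt_def by (rule prob_space_distr) measurable
qed

lemma distr_squared_hoyt:
  assumes "prob_space M"
    and "prob_space.indep_var M borel X borel Y"
    and "distr M borel X = centered_gaussian (hoyt_var_x q g)"
    and "distr M borel Y = centered_gaussian (hoyt_var_y q g)"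
  shows "distr M borel (\<lambda>w. (X w)\<^sup>2 + (Y w)\<^sup>2) = squared_hoyt q g"
proof -
  interpret prob_space M by fact
  have [measurable]: "X \<in> borel_measurable M" "Y \<in> borel_measurable M"
    using assms(2) by (auto dest: indep_var_rv1 indep_var_rv2)
  have "distr M borel X \<Otimes>\<^sub>M distr M borel Y = distr M (borel \<Otimes>\<^sub>M borel) (\<lambda>w. (X w, Y w))"
    using assms(2) by (simp add: indep_var_distribution_eq)
  then show ?thesis
    unfolding squared_hoyt_def assms(3,4)[symmetric]
    by (simp add: distr_distr comp_def)
qed

end

(* The average capacity is squeezed via t - t^2 <= ln (1 + t) <= t, where for t = x^2 + y^2 one has
   t^2 <= 2 x^4 + 2 y^4. As the Gaussian moments are E X^2 = v and E X^4 = 3 v^2, this yields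
   g - 6 g^2 <= E ln (1 + gamma) <= g. *)
theory Submission imports Defs begin

text \<open>The intermediate bound is \<open>t / (1 + t)\<close>: multiplying
  \<open>t - t\<^sup>2\<close> by \<open>1 + t\<close> leaves \<open>t - t ^ 3\<close>, which is at
  most \<open>t\<close>, and \<open>ln s \<le> s - 1\<close> at \<open>s = inverse (1 + t)\<close>
  gives the rest.\<close>

lemma diff_square_le_ln_one_plus:
  fixes t :: real
  assumes "0 \<le> t"
  shows "t - t\<^sup>2 \<le> ln (1 + t)"
proof -
  have "t - t\<^sup>2 \<le> t / (1 + t)"
  proof -
    have "(t - t\<^sup>2) * (1 + t) = t - t ^ 3"
      by (simp add: algebra_simps power2_eq_square power3_eq_cube)
    then show ?thesis
      using assms by (simp add: pos_le_divide_eq)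
  qed
  also have "\<dots> = 1 - inverse (1 + t)"
    using assms by (simp add: field_simps)
  also have "\<dots> \<le> ln (1 + t)"
    using assms ln_le_minus_one[of "inverse (1 + t)"] by (simp add: ln_inverse)
  finally show ?thesis .
qed

text \<open>Under a point mass \<open>f\<close> agrees almost everywhere with the constant
  \<open>f x\<close>. This supplies the moments of the degenerate Gaussian of variance 0, which
  occurs for \<open>q = 0\<close>.\<close>

lemma has_bochner_integral_return:
  fixes f :: "'a \<Rightarrow> 'b :: {banach, second_countable_topology}"
  assumes "x \<in> space M" and [measurable]: "f \<in> borel_measurable M"
  shows "has_bochner_integral (return M x) f (f x)"
proof -
  interpret prob_space "return M x"
    by (rule prob_space_return) fact
  have const: "has_bochner_integral (return M x) (\<lambda>_. f x) (f x)"
    using prob_space by (simp add: has_bochner_integral_iff)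
  have "AE y in return M x. f y = f x"
    using assms(1) by (subst AE_return) simp_all
  moreover have "f \<in> borel_measurable (return M x)" "(\<lambda>_. f x) \<in> borel_measurable (return M x)"
    by simp_all
  ultimately have "has_bochner_integral (return M x) f (f x) \<longleftrightarrow>
      has_bochner_integral (return M x) (\<lambda>_. f x) (f x)"
    by (intro has_bochner_integral_cong_AE)
  with const show ?thesis
    by (rule iffD2[rotated])
qed

text \<open>The coefficient is the double factorial (2k-1)!!. Covering \<open>v = 0\<close> as well
  lets the later estimates treat all \<open>q\<close> uniformly.\<close>

lemma has_bochner_integral_centered_gaussian_even_power:
  assumes "0 \<le> v"
  shows "has_bochner_integral (centered_gaussian v) (\<lambda>x. x ^ (2 * k))
    (fact (2 * k) / (2 ^ k * fact k) * v ^ k)"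
proof (cases "v = 0")
  case True
  have "has_bochner_integral (return borel 0) (\<lambda>x::real. x ^ (2 * k)) (0 ^ (2 * k))"
    by (rule has_bochner_integral_return) simp_all
  with True show ?thesis
    \<comment> \<open>For \<open>k = 0\<close> both sides are 1, since \<open>0 ^ 0 = 1\<close>; for
      positive \<open>k\<close> both vanish.\<close>
    by (cases k) (simp_all add: centered_gaussian_def)
next
  case False
  with assms have "0 < v" by simp
  then have "has_bochner_integral lborel (\<lambda>x. normal_density 0 (sqrt v) x *\<^sub>R x ^ (2 * k))
      (fact (2 * k) / (2 ^ k * fact k) * v ^ k)"
    using normal_moment_even[of "sqrt v" 0 k] by (simp add: power_divide)
  then have "has_bochner_integral (density lborel (normal_density 0 (sqrt v))) (\<lambda>x. x ^ (2 * k))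
      (fact (2 * k) / (2 ^ k * fact k) * v ^ k)"
    by (intro has_bochner_integral_density) simp_all
  with False show ?thesis
    by (simp add: centered_gaussian_def)
qed

lemma has_bochner_integral_centered_gaussian_power2:
  "0 \<le> v \<Longrightarrow> has_bochner_integral (centered_gaussian v) (\<lambda>x. x\<^sup>2) v"
  using has_bochner_integral_centered_gaussian_even_power[of v 1] by simp

lemma has_bochner_integral_centered_gaussian_power4:
  "0 \<le> v \<Longrightarrow> has_bochner_integral (centered_gaussian v) (\<lambda>x. x ^ 4) (3 * v\<^sup>2)"
  using has_bochner_integral_centered_gaussian_even_power[of v 2] by (simp add: fact_numeral)

text \<open>Swapping the factors turns the second marginal into a first marginal, for which
  \<open>distr_pair_fst\<close> applies.\<close>

lemma (in pair_prob_space) distr_pair_snd: "distr (M1 \<Otimes>\<^sub>M M2) M2 snd = M2"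
proof -
  have "distr (M1 \<Otimes>\<^sub>M M2) M2 snd = distr (M2 \<Otimes>\<^sub>M M1) M2 (snd \<circ> (\<lambda>(x, y). (y, x)))"
    by (subst distr_pair_swap, subst distr_distr) simp_all
  also have "\<dots> = distr (M2 \<Otimes>\<^sub>M M1) M2 fst"
    by (rule distr_cong) auto
  finally show ?thesis
    by (simp add: M1.distr_pair_fst)
qed

text \<open>Change of variables along the projection, whose image measure is the first
  factor.\<close>

lemma (in pair_prob_space) has_bochner_integral_fst:
  fixes f :: "'a \<Rightarrow> 'c :: {banach, second_countable_topology}"
  assumes "has_bochner_integral M1 f c"
  shows "has_bochner_integral (M1 \<Otimes>\<^sub>M M2) (\<lambda>z. f (fst z)) c"
proof -
  have "has_bochner_integral (distr (M1 \<Otimes>\<^sub>M M2) M1 fst) f c"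
    using assms by (simp add: M2.distr_pair_fst)
  moreover have "f \<in> borel_measurable M1"
    using assms by (auto simp: has_bochner_integral_iff)
  ultimately show ?thesis
    by (simp add: has_bochner_integral_iff integrable_distr_eq integral_distr)
qed

lemma (in pair_prob_space) has_bochner_integral_snd:
  fixes f :: "'b \<Rightarrow> 'c :: {banach, second_countable_topology}"
  assumes "has_bochner_integral M2 f c"
  shows "has_bochner_integral (M1 \<Otimes>\<^sub>M M2) (\<lambda>z. f (snd z)) c"
proof -
  have "has_bochner_integral (distr (M1 \<Otimes>\<^sub>M M2) M2 snd) f c"
    using assms by (simp add: distr_pair_snd)
  moreover have "f \<in> borel_measurable M2"
    using assms by (auto simp: has_bochner_integral_iff)
  ultimately show ?thesis
    by (simp add: has_bochner_integral_iff integrable_distr_eq integral_distr)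
qed

lemma hoyt_ln_bounds:
  assumes "0 < g"
  shows "g - 6 * g\<^sup>2 \<le> (\<integral>\<gamma>. ln (1 + \<gamma>) \<partial>squared_hoyt q g)"
    and "(\<integral>\<gamma>. ln (1 + \<gamma>) \<partial>squared_hoyt q g) \<le> g"
proof -
  define a b where "a = hoyt_var_x q g" and "b = hoyt_var_y q g"
  have nonneg: "0 \<le> a" "0 \<le> b"
    using assms by (auto simp: a_def b_def hoyt_var_x_def hoyt_var_y_def)
  have sum: "a + b = g"
    using hoyt_variances_iff[of b q a g] by (simp add: a_def b_def)
  interpret A: prob_space "centered_gaussian a"
    using nonneg(1) by (rule prob_space_centered_gaussian)
  interpret B: prob_space "centered_gaussian b"
    using nonneg(2) by (rule prob_space_centered_gaussian)
  interpret pair_prob_space "centered_gaussian a" "centered_gaussian b" ..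
  define P where "P = centered_gaussian a \<Otimes>\<^sub>M centered_gaussian b"
  have [measurable_cong]: "sets P = sets (borel \<Otimes>\<^sub>M borel)"
    unfolding P_def by (rule sets_pair_measure_cong) simp_all
  define T :: "real \<times> real \<Rightarrow> real" where "T = (\<lambda>z. (fst z)\<^sup>2 + (snd z)\<^sup>2)"
  \<comment> \<open>Bounding the square of \<open>T\<close> by pure fourth powers avoids the mixed
    term in \<open>fst z\<close> and \<open>snd z\<close>, so marginal moments suffice to integrate
    \<open>L\<close>.\<close>
  define L :: "real \<times> real \<Rightarrow> real"
    where "L = (\<lambda>z. T z - (2 * (fst z) ^ 4 + 2 * (snd z) ^ 4))"
  have [measurable]: "T \<in> borel_measurable P"
    unfolding T_def by measurable
  have T: "has_bochner_integral P T (a + b)"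
    unfolding T_def P_def using nonneg
    by (intro has_bochner_integral_add has_bochner_integral_fst has_bochner_integral_snd
          has_bochner_integral_centered_gaussian_power2)
  have L: "has_bochner_integral P L (a + b - (2 * (3 * a\<^sup>2) + 2 * (3 * b\<^sup>2)))"
    unfolding L_def
  proof (intro has_bochner_integral_diff[OF T] has_bochner_integral_add
      has_bochner_integral_mult_right)
    show "has_bochner_integral P (\<lambda>z. fst z ^ 4) (3 * a\<^sup>2)"
      unfolding P_def using nonneg(1)
      by (intro has_bochner_integral_fst[where f = "\<lambda>x. x ^ 4"]
          has_bochner_integral_centered_gaussian_power4)
    show "has_bochner_integral P (\<lambda>z. snd z ^ 4) (3 * b\<^sup>2)"
      unfolding P_def using nonneg(2)
      by (intro has_bochner_integral_snd[where f = "\<lambda>x. x ^ 4"]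
          has_bochner_integral_centered_gaussian_power4)
  qed
  have T_nonneg: "0 \<le> T z" for z
    by (simp add: T_def)
  have ln_nonneg: "0 \<le> ln (1 + T z)" for z
    using T_nonneg[of z] by simp
  have ln_le: "ln (1 + T z) \<le> T z" for z
    using T_nonneg[of z] by (rule ln_add_one_self_le_self)
  have le_ln: "L z \<le> ln (1 + T z)" for z
  proof -
    \<comment> \<open>The gap between the two bounds is a perfect square, hence nonnegative.\<close>
    have "2 * fst z ^ 4 + 2 * snd z ^ 4 - (T z)\<^sup>2 = ((fst z)\<^sup>2 - (snd z)\<^sup>2)\<^sup>2"
      by (simp add: T_def power2_eq_square power4_eq_xxxx algebra_simps)
    then have "L z \<le> T z - (T z)\<^sup>2"
      using zero_le_power2[of "(fst z)\<^sup>2 - (snd z)\<^sup>2"] unfolding L_def by linarith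
    also have "\<dots> \<le> ln (1 + T z)"
      using T_nonneg by (rule diff_square_le_ln_one_plus)
    finally show ?thesis .
  qed
  \<comment> \<open>Both uses of \<open>integral_mono\<close> below require integrability;
    \<open>T\<close> is the dominating function.\<close>
  have int: "integrable P (\<lambda>z. ln (1 + T z))"
  proof (rule Bochner_Integration.integrable_bound)
    show "integrable P T"
      using T by (rule integrable.intros)
    show "AE z in P. norm (ln (1 + T z)) \<le> norm (T z)"
      using T_nonneg ln_nonneg ln_le by simp
  qed measurable
  have "squared_hoyt q g = distr P borel T"
    unfolding squared_hoyt_def P_def T_def a_def b_def by (simp add: case_prod_beta')
  then have eq: "(\<integral>\<gamma>. ln (1 + \<gamma>) \<partial>squared_hoyt q g) = (\<integral>z. ln (1 + T z) \<partial>P)"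
    by (simp add: integral_distr)
  have "(\<integral>z. ln (1 + T z) \<partial>P) \<le> integral\<^sup>L P T"
    using int integrable.intros[OF T] ln_le by (rule integral_mono)
  then show "(\<integral>\<gamma>. ln (1 + \<gamma>) \<partial>squared_hoyt q g) \<le> g"
    using eq sum has_bochner_integral_integral_eq[OF T] by simp
  \<comment> \<open>The 6 is the factor 2 in \<open>L\<close> times the 3 of the fourth moment.
    Dropping the cross term \<open>2 * a * b \<ge> 0\<close> of \<open>(a + b)\<^sup>2\<close> makes
    the error independent of \<open>q\<close>.\<close>
  have "6 * (a\<^sup>2 + b\<^sup>2) \<le> 6 * g\<^sup>2"
    using nonneg by (simp add: sum[symmetric] power2_sum)
  then have "g - 6 * g\<^sup>2 \<le> integral\<^sup>L P L"
    using sum has_bochner_integral_integral_eq[OF L] by simp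
  also have "\<dots> \<le> (\<integral>z. ln (1 + T z) \<partial>P)"
    using integrable.intros[OF L] int le_ln by (rule integral_mono)
  finally show "g - 6 * g\<^sup>2 \<le> (\<integral>\<gamma>. ln (1 + \<gamma>) \<partial>squared_hoyt q g)"
    using eq by simp
qed

text \<open>Numerator and denominator both carry the factor \<open>1 / ln 2\<close>, which cancels
  and leaves natural logarithms.\<close>

lemma hoyt_capacity_ratio_eq:
  "hoyt_capacity q g / (log 2 (exp 1) * g) = (\<integral>\<gamma>. ln (1 + \<gamma>) \<partial>squared_hoyt q g) / g"
  by (simp add: hoyt_capacity_def log_def)

theorem mainTheorem6:
  fixes q :: real
  assumes "q \<in> {0..1}"
  shows "((\<lambda>g. hoyt_capacity q g / (log 2 (exp 1) * g)) \<longlongrightarrow> 1) (at_right 0)"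
proof (rule tendsto_sandwich)
  \<comment> \<open>To the right of 0, \<open>g\<close> is positive, so the bounds of
    \<open>hoyt_ln_bounds\<close> may be divided by \<open>g\<close>.\<close>
  show "\<forall>\<^sub>F g in at_right 0. 1 - 6 * g \<le> hoyt_capacity q g / (log 2 (exp 1) * g)"
    using eventually_at_right_less
  proof eventually_elim
    case (elim g)
    then show ?case
      unfolding hoyt_capacity_ratio_eq pos_le_divide_eq[OF elim]
      using hoyt_ln_bounds(1)[OF elim, of q] by (simp add: left_diff_distrib power2_eq_square)
  qed
  show "\<forall>\<^sub>F g in at_right 0. hoyt_capacity q g / (log 2 (exp 1) * g) \<le> 1"
    using eventually_at_right_less
  proof eventually_elim
    case (elim g)
    then show ?case
      using hoyt_ln_bounds(2)[OF elim, of q] unfolding hoyt_capacity_ratio_eq by simp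
  qed
  show "((\<lambda>g::real. 1 - 6 * g) \<longlongrightarrow> 1) (at_right 0)"
    by (auto intro!: tendsto_eq_intros)
qed simp

end
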